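(* Let $S\subset\mathbb{R}^m$ be a compact semialgebraic set and let $T\subset\mathbb{R}^n$ be a compact polyhedron. Then $\mathcal{S}^\nu(S,T)$ is dense in $\mathcal{S}^0(S,T)$ (with the $\mathcal{S}^0$ topology) for each integer $\nu\geq 1$.
   Context: A compact polyhedron of $\mathbb{R}^n$ is the realization $|K|$ of a finite simplicial complex $K$ of $\mathbb{R}^n$. A map between semialgebraic sets is semialgebraic if its graph is a semialgebraic set. For an integer $\nu\ge 0$ and an open semialgebraic set $U\subset\mathbb{R}^m$, $\mathcal{S}^\nu(U)$ is the set of semialgebraic functions $U\to\mathbb{R}$ of class $\mathcal{C}^\nu$. A function $f:S\to\mathbb{R}$ on a semialgebraic set $S\subset\mathbb{R}^m$ is $\mathcal{S}^\nu$ if there are an open semialgebraic neighborhood $U$ of $S$ in $\mathbb{R}^m$ and $F\in\mathcal{S}^\nu(U)$ with $F|_S=f$. A map $f=(f_1,\dots,f_n):S\to T\subset\mathbb{R}^n$ between semialgebraic sets is $\mathcal{S}^\nu$ if each $f_i:S\to\mathbb{R}$ is an $\mathcal{S}^\nu$ function; $\mathcal{S}^\nu(S,T)$ denotes the set of these maps. For $S$ compact, $\mathcal{S}^0(S,T)$ is the set of continuous semialgebraic maps $S\to T$, and the $\mathcal{S}^0$ topology on it is the topology of uniform convergence. *)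

theory Defs
  imports "HOL-Analysis.Analysis"
begin

text \<open>On a Euclidean space the bounded linear functionals are the linear combinations of the
  coordinates, so \<^const>\<open>real_polynomial_function\<close> is exactly the class of polynomial functions
  with real coefficients. Sets \<open>{x. p x = 0}\<close> are obtained as
  \<open>- ({x. p x > 0} \<union> {x. - p x > 0})\<close>.\<close>

inductive semialgebraic :: "'a::euclidean_space set \<Rightarrow> bool" where
  positive: "real_polynomial_function p \<Longrightarrow> semialgebraic {x. p x > 0}"
| complement: "semialgebraic A \<Longrightarrow> semialgebraic (- A)"
| union: "semialgebraic A \<Longrightarrow> semialgebraic B \<Longrightarrow> semialgebraic (A \<union> B)"

definition semialgebraic_on ::
    "'a::euclidean_space set \<Rightarrow> ('a \<Rightarrow> 'b::euclidean_space) \<Rightarrow> bool" where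
  "semialgebraic_on S f \<longleftrightarrow> semialgebraic {(x, f x) | x. x \<in> S}"

text \<open>Only meant for open \<open>U\<close>. For \<open>b\<close> in \<^const>\<open>Basis\<close>, the function
  \<open>\<lambda>x. frechet_derivative f (at x) b\<close> is the partial derivative of \<open>f\<close> in direction \<open>b\<close>.\<close>

fun Ck_on :: "nat \<Rightarrow> 'a::euclidean_space set \<Rightarrow> ('a \<Rightarrow> real) \<Rightarrow> bool" where
  "Ck_on 0 U f \<longleftrightarrow> continuous_on U f"
| "Ck_on (Suc k) U f \<longleftrightarrow>
     (\<forall>x\<in>U. f differentiable (at x)) \<and>
     (\<forall>b\<in>Basis. Ck_on k U (\<lambda>x. frechet_derivative f (at x) b))"

definition Snu_open :: "nat \<Rightarrow> 'a::euclidean_space set \<Rightarrow> ('a \<Rightarrow> real) \<Rightarrow> bool" where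
  "Snu_open \<nu> U F \<longleftrightarrow> open U \<and> semialgebraic U \<and> semialgebraic_on U F \<and> Ck_on \<nu> U F"

definition Snu_function :: "nat \<Rightarrow> 'a::euclidean_space set \<Rightarrow> ('a \<Rightarrow> real) \<Rightarrow> bool" where
  "Snu_function \<nu> S f \<longleftrightarrow> (\<exists>U F. S \<subseteq> U \<and> Snu_open \<nu> U F \<and> (\<forall>x\<in>S. F x = f x))"

text \<open>Sets of maps \<open>S \<rightarrow> T\<close> consist of extensional functions, so that each map is
  represented exactly once.\<close>

definition Snu_maps ::
    "nat \<Rightarrow> 'a::euclidean_space set \<Rightarrow> (real^'n) set \<Rightarrow> ('a \<Rightarrow> real^'n) set" where
  "Snu_maps \<nu> S T = {f \<in> S \<rightarrow>\<^sub>E T. \<forall>i. Snu_function \<nu> S (\<lambda>x. f x $ i)}"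

text \<open>Continuous semialgebraic maps, the meaning of the case \<open>\<nu> = 0\<close> for compact \<open>S\<close>; unlike in
  \<open>Snu_maps 0 S T\<close>, no extension to a neighbourhood of \<open>S\<close> is required.\<close>

definition S0_maps ::
    "'a::euclidean_space set \<Rightarrow> (real^'n) set \<Rightarrow> ('a \<Rightarrow> real^'n) set" where
  "S0_maps S T = {f \<in> S \<rightarrow>\<^sub>E T. continuous_on S f \<and> semialgebraic_on S f}"

text \<open>The topology of uniform convergence over \<open>S\<close> on the set \<open>X\<close> of maps.\<close>

definition uniform_topology ::
    "'a set \<Rightarrow> ('a \<Rightarrow> 'b::metric_space) set \<Rightarrow> ('a \<Rightarrow> 'b) topology" where
  "uniform_topology S X = topology (\<lambda>W. W \<subseteq> X \<and>
     (\<forall>f\<in>W. \<exists>e>0. \<forall>g\<in>X. (\<forall>x\<in>S. dist (f x) (g x) < e) \<longrightarrow> g \<in> W))"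

lemma openin_uniform_topology:
  "openin (uniform_topology S X) W \<longleftrightarrow> W \<subseteq> X \<and>
     (\<forall>f\<in>W. \<exists>e>0. \<forall>g\<in>X. (\<forall>x\<in>S. dist (f x) (g x) < e) \<longrightarrow> g \<in> W)"
proof -
  let ?near = "\<lambda>e f g. \<forall>x\<in>S. dist (f x) (g x) < e"
  let ?P = "\<lambda>W. W \<subseteq> X \<and> (\<forall>f\<in>W. \<exists>e>0. \<forall>g\<in>X. ?near e f g \<longrightarrow> g \<in> W)"
  have int: "?P (A \<inter> B)" if "?P A" "?P B" for A B
  proof (intro conjI ballI)
    show "A \<inter> B \<subseteq> X" using that by blast
    fix f assume f: "f \<in> A \<inter> B"
    from f that obtain d where d: "d > 0" "\<forall>g\<in>X. ?near d f g \<longrightarrow> g \<in> A" by blast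
    from f that obtain e where e: "e > 0" "\<forall>g\<in>X. ?near e f g \<longrightarrow> g \<in> B" by blast
    show "\<exists>e>0. \<forall>g\<in>X. ?near e f g \<longrightarrow> g \<in> A \<inter> B"
      by (rule exI[of _ "min d e"]) (use d e in auto)
  qed
  have uni: "?P (\<Union>\<K>)" if "\<forall>W\<in>\<K>. ?P W" for \<K>
  proof (intro conjI ballI)
    show "\<Union>\<K> \<subseteq> X" using that by blast
    fix f assume "f \<in> \<Union>\<K>"
    then obtain W where W: "W \<in> \<K>" "f \<in> W" by blast
    with that obtain e where "e > 0" "\<forall>g\<in>X. ?near e f g \<longrightarrow> g \<in> W" by blast
    with W show "\<exists>e>0. \<forall>g\<in>X. ?near e f g \<longrightarrow> g \<in> \<Union>\<K>" by blast
  qed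
  have "istopology ?P"
    unfolding istopology_def
  proof (rule conjI)
    show "\<forall>A B. ?P A \<longrightarrow> ?P B \<longrightarrow> ?P (A \<inter> B)"
      using int by (intro allI impI)
    show "\<forall>\<K>. (\<forall>W\<in>\<K>. ?P W) \<longrightarrow> ?P (\<Union>\<K>)"
      using uni by (intro allI impI)
  qed
  then show ?thesis
    unfolding uniform_topology_def by (simp add: topology_inverse')
qed

lemma topspace_uniform_topology [simp]: "topspace (uniform_topology S X) = X"
proof
  show "topspace (uniform_topology S X) \<subseteq> X"
    unfolding topspace_def by (auto simp: openin_uniform_topology)
  have "openin (uniform_topology S X) X"
    unfolding openin_uniform_topology by (auto intro: exI[of _ 1])
  then show "X \<subseteq> topspace (uniform_topology S X)"
    by (rule openin_subset)
qed

definition compact_polyhedron :: "'a::euclidean_space set \<Rightarrow> bool" where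
  "compact_polyhedron T \<longleftrightarrow> (\<exists>K. simplicial_complex K \<and> T = \<Union>K)"

definition dense_in :: "'a topology \<Rightarrow> 'a set \<Rightarrow> bool" where
  "dense_in X A \<longleftrightarrow> A \<subseteq> topspace X \<and> X closure_of A = topspace X"

end

theory Submission
  imports Defs
begin

text \<open>Subdivide \<open>T\<close> finely and choose continuous functions on \<open>T\<close>, attached to finitely many
  points \<open>v\<close> of the cells, that behave like barycentric coordinates. Their compositions with the
  given map are continuous functions on the compact set \<open>S\<close>, so Stone--Weierstrass approximates
  them by polynomials. Lowering these polynomials by a small constant and replacing them by powers
  of their positive parts gives functions of class \<open>C\<^sup>\<nu>\<close> which are positive at \<open>x\<close> only for points
  \<open>v\<close> in a common cell around \<open>f x\<close>. The weighted means of the points \<open>v\<close> then form a map into \<open>T\<close>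
  whose value at \<open>x\<close> lies in the same small cell as \<open>f x\<close>.\<close>

section \<open>Semialgebraic sets\<close>

lemma semialgebraic_empty [simp]: "semialgebraic {}"
  using semialgebraic.positive[OF real_polynomial_function.intros(2)[of 0]] by simp

lemma semialgebraic_UNIV [simp]: "semialgebraic UNIV"
  using semialgebraic.complement[OF semialgebraic_empty] by simp

lemma semialgebraic_Int:
  assumes "semialgebraic A" "semialgebraic B"
  shows "semialgebraic (A \<inter> B)"
proof -
  have "semialgebraic (- (- A \<union> - B))"
    by (intro semialgebraic.intros assms)
  then show ?thesis by simp
qed

lemma semialgebraic_UN:
  "finite I \<Longrightarrow> (\<And>i. i \<in> I \<Longrightarrow> semialgebraic (A i)) \<Longrightarrow> semialgebraic (\<Union>i\<in>I. A i)"
  by (induction I rule: finite_induct) (auto intro: semialgebraic.union)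

lemma semialgebraic_INT:
  "finite I \<Longrightarrow> (\<And>i. i \<in> I \<Longrightarrow> semialgebraic (A i)) \<Longrightarrow> semialgebraic (\<Inter>i\<in>I. A i)"
  by (induction I rule: finite_induct) (auto intro: semialgebraic_Int)

lemma semialgebraic_zero:
  assumes "real_polynomial_function p"
  shows "semialgebraic {x. p x = 0}"
proof -
  have "{x. p x = 0} = - ({x. p x > 0} \<union> {x. - p x > 0})"
    by auto
  also have "semialgebraic \<dots>"
    by (intro semialgebraic.intros real_polynomial_function_minus assms)
  finally show ?thesis .
qed

text \<open>A polynomial composed with a linear map is again a polynomial, so the generating sets
  pull back to generating sets. The maps \<open>h\<close> of interest are coordinate maps of a
  product, along which graphs are pulled back.\<close>

lemma semialgebraic_vimage:
  assumes h: "bounded_linear h" and "semialgebraic A"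
  shows "semialgebraic (h -` A)"
  using assms(2)
proof induction
  case (positive p)
  have "real_polynomial_function (p \<circ> h)"
    using real_polynomial_function_compose[OF polynomial_function_bounded_linear[OF h] positive] .
  then show ?case
    using semialgebraic.positive[of "p \<circ> h"] by (simp add: vimage_def)
next
  case (complement A)
  then show ?case
    by (simp add: vimage_Compl semialgebraic.complement)
next
  case (union A B)
  then show ?case
    by (simp add: semialgebraic.union)
qed

text \<open>The graph of \<open>f\<close> is the intersection of the pullbacks of the component
  graphs along the linear maps \<open>(x, y) \<mapsto> (x, y $ i)\<close>. The factor over
  \<open>S\<close> cuts the domains \<open>U i\<close>, which may differ from one coordinate to
  another, down to \<open>S\<close>.\<close>

lemma semialgebraic_on_vec:
  fixes f :: "'a::euclidean_space \<Rightarrow> real^'n"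
  assumes S: "semialgebraic S" and SU: "\<And>i. S \<subseteq> U i"
    and F: "\<And>i. semialgebraic_on (U i) (F i)"
    and eq: "\<And>i x. x \<in> S \<Longrightarrow> F i x = f x $ i"
  shows "semialgebraic_on S f"
proof -
  let ?G = "\<lambda>i. {(x, F i x) | x. x \<in> U i}"
  let ?h = "\<lambda>i (z :: 'a \<times> (real^'n)). (fst z, snd z $ i)"
  have h: "bounded_linear (?h i)" for i
    by (intro bounded_linear_Pair bounded_linear_fst
        bounded_linear_compose[OF bounded_linear_vec_nth bounded_linear_snd])
  have "{(x, f x) | x. x \<in> S} = fst -` S \<inter> (\<Inter>i\<in>UNIV. ?h i -` ?G i)"
    using subsetD[OF SU] eq by (auto simp: vec_eq_iff)
  also have "semialgebraic \<dots>"
    using F unfolding semialgebraic_on_def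
    by (intro semialgebraic_Int semialgebraic_INT semialgebraic_vimage h S bounded_linear_fst) auto
  finally show ?thesis
    unfolding semialgebraic_on_def .
qed

section \<open>Functions of class \<open>C\<^sup>k\<close>\<close>

lemma frechet_derivative_cong_open:
  assumes "open U" "x \<in> U" "\<And>y. y \<in> U \<Longrightarrow> f y = g y" "f differentiable (at x)"
  shows "g differentiable (at x)" "frechet_derivative g (at x) = frechet_derivative f (at x)"
proof -
  have "(f has_derivative frechet_derivative f (at x)) (at x)"
    using assms(4) by (simp add: frechet_derivative_works)
  then have "(g has_derivative frechet_derivative f (at x)) (at x)"
    using assms(1-3) by (rule has_derivative_transform_within_open)
  then show "g differentiable (at x)" "frechet_derivative g (at x) = frechet_derivative f (at x)"
    by (auto simp: differentiable_def dest: frechet_derivative_at)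
qed

lemma Ck_on_cong:
  assumes "open U"
  shows "Ck_on k U f \<Longrightarrow> (\<And>x. x \<in> U \<Longrightarrow> f x = g x) \<Longrightarrow> Ck_on k U g"
proof (induction k arbitrary: f g)
  case 0
  then show ?case using continuous_on_cong[of U U f g] by simp
next
  case (Suc k)
  have g: "g differentiable (at x)" "frechet_derivative g (at x) = frechet_derivative f (at x)"
    if "x \<in> U" for x
    using frechet_derivative_cong_open[OF assms that Suc.prems(2)] Suc.prems(1) that by auto
  have "Ck_on k U (\<lambda>x. frechet_derivative g (at x) b)" if "b \<in> Basis" for b
  proof (rule Suc.IH)
    show "Ck_on k U (\<lambda>x. frechet_derivative f (at x) b)"
      using Suc.prems(1) that by simp
  qed (simp add: g)
  with g show ?case
    by simp
qed

text \<open>The recursion in \<open>Ck_on\<close> refers to the chosen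
  \<open>frechet_derivative\<close>. By uniqueness of derivatives this agrees on \<open>U\<close>
  with any explicit formula \<open>D\<close>, which the calculus rules below supply.\<close>

lemma Ck_on_SucI:
  assumes "open U" "\<And>x. x \<in> U \<Longrightarrow> (f has_derivative D x) (at x)"
    and "\<And>b. b \<in> Basis \<Longrightarrow> Ck_on k U (\<lambda>x. D x b)"
  shows "Ck_on (Suc k) U f"
  unfolding Ck_on.simps
proof (intro conjI ballI)
  show "f differentiable (at x)" if "x \<in> U" for x
    using assms(2)[OF that] by (auto simp: differentiable_def)
  show "Ck_on k U (\<lambda>x. frechet_derivative f (at x) b)" if "b \<in> Basis" for b
    by (rule Ck_on_cong[OF assms(1) assms(3)[OF that]])
      (metis assms(2) frechet_derivative_at)
qed

lemma Ck_on_SucD: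
  assumes "Ck_on (Suc k) U f"
  shows "x \<in> U \<Longrightarrow> (f has_derivative frechet_derivative f (at x)) (at x)"
    and "b \<in> Basis \<Longrightarrow> Ck_on k U (\<lambda>x. frechet_derivative f (at x) b)"
  using assms by (auto simp: frechet_derivative_works)

lemma Ck_on_imp_continuous_on: "Ck_on k U f \<Longrightarrow> continuous_on U f"
  by (cases k) (auto intro!: continuous_at_imp_continuous_on differentiable_imp_continuous_within)

lemma Ck_on_Suc_imp: "Ck_on (Suc k) U f \<Longrightarrow> Ck_on k U f"
proof (induction k arbitrary: f)
  case 0
  show ?case using Ck_on_imp_continuous_on[OF 0] by simp
next
  case (Suc k)
  then show ?case by (metis Ck_on.simps(2))
qed

lemma Ck_on_const: "open U \<Longrightarrow> Ck_on k U (\<lambda>x. c)"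
proof (induction k arbitrary: c)
  case (Suc k)
  show ?case
    by (rule Ck_on_SucI[where D = "\<lambda>x h. 0"]) (use Suc in auto)
qed simp

lemma Ck_on_add:
  "open U \<Longrightarrow> Ck_on k U f \<Longrightarrow> Ck_on k U g \<Longrightarrow> Ck_on k U (\<lambda>x. f x + g x)"
proof (induction k arbitrary: f g)
  case 0
  then show ?case by (auto intro: continuous_intros)
next
  case (Suc k)
  note f = Ck_on_SucD[OF Suc.prems(2)] and g = Ck_on_SucD[OF Suc.prems(3)]
  show ?case
    by (rule Ck_on_SucI[OF Suc.prems(1) has_derivative_add[OF f(1) g(1)]])
      (auto intro: Suc.IH Suc.prems(1) f(2) g(2))
qed

lemma Ck_on_mult:
  "open U \<Longrightarrow> Ck_on k U f \<Longrightarrow> Ck_on k U g \<Longrightarrow> Ck_on k U (\<lambda>x. f x * g x)"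
proof (induction k arbitrary: f g)
  case 0
  then show ?case by (auto intro: continuous_intros)
next
  case (Suc k)
  note f = Ck_on_SucD[OF Suc.prems(2)] and g = Ck_on_SucD[OF Suc.prems(3)]
  \<comment> \<open>The product rule multiplies derivatives by the factors themselves, so
    \<open>f\<close> and \<open>g\<close> must first be lowered from class \<open>Suc k\<close> to
    class \<open>k\<close>.\<close>
  show ?case
    by (rule Ck_on_SucI[OF Suc.prems(1) has_derivative_mult[OF f(1) g(1)]])
      (auto intro!: Ck_on_add Suc.IH Suc.prems(1) f(2) g(2) Ck_on_Suc_imp[OF Suc.prems(2)]
        Ck_on_Suc_imp[OF Suc.prems(3)])
qed

lemma Ck_on_sum:
  "finite I \<Longrightarrow> open U \<Longrightarrow> (\<And>i. i \<in> I \<Longrightarrow> Ck_on k U (f i)) \<Longrightarrow> Ck_on k U (\<lambda>x. \<Sum>i\<in>I. f i x)"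
  by (induction I rule: finite_induct) (auto intro: Ck_on_const Ck_on_add)

lemma Ck_on_inverse:
  "open U \<Longrightarrow> Ck_on k U f \<Longrightarrow> (\<And>x. x \<in> U \<Longrightarrow> f x \<noteq> 0) \<Longrightarrow> Ck_on k U (\<lambda>x. inverse (f x))"
proof (induction k)
  case 0
  then show ?case by (auto intro: continuous_intros)
next
  case (Suc k)
  note f = Ck_on_SucD[OF Suc.prems(2)]
  \<comment> \<open>The derivative of the inverse contains the inverse again; there it is needed
    only in class \<open>k\<close>, which is the induction hypothesis.\<close>
  have inv: "Ck_on k U (\<lambda>x. inverse (f x))"
    by (intro Suc.IH Suc.prems Ck_on_Suc_imp[OF Suc.prems(2)])
  show ?case
  proof (rule Ck_on_SucI[OF Suc.prems(1)])
    show "((\<lambda>x. inverse (f x)) has_derivative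
        (\<lambda>h. (- 1) * (inverse (f x) * frechet_derivative f (at x) h * inverse (f x)))) (at x)"
      if "x \<in> U" for x
      using Deriv.has_derivative_inverse[OF Suc.prems(3)[OF that] f(1)[OF that]] by simp
    show "Ck_on k U (\<lambda>x. (- 1) * (inverse (f x) * frechet_derivative f (at x) b * inverse (f x)))"
      if "b \<in> Basis" for b
      by (intro Ck_on_mult Ck_on_const inv f(2) that Suc.prems(1))
  qed
qed

lemma Ck_on_real_polynomial_function:
  assumes "open U" "real_polynomial_function p"
  shows "Ck_on k U p"
  using assms(2)
proof induction
  case (linear f)
  show ?case
  proof (cases k)
    case 0
    then show ?thesis using linear by (simp add: linear_continuous_on)
  next
    case (Suc j)
    show ?thesis
      unfolding Suc
      by (rule Ck_on_SucI[where D = "\<lambda>x. f"])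
        (auto intro: bounded_linear_imp_has_derivative linear Ck_on_const assms(1))
  qed
qed (auto intro: Ck_on_const Ck_on_add Ck_on_mult assms(1))

text \<open>The exponent is at least 2, so the corner of the positive part at 0 is flattened. Away
  from 0 the function is locally zero or a pure power.\<close>

lemma has_real_derivative_max_0_power:
  "((\<lambda>t::real. max 0 t ^ Suc (Suc k)) has_real_derivative real (Suc (Suc k)) * max 0 t ^ Suc k) (at t)"
proof (cases t "0 :: real" rule: linorder_cases)
  case less
  have "((\<lambda>t::real. 0) has_real_derivative 0) (at t)"
    by simp
  then have "((\<lambda>t::real. max 0 t ^ Suc (Suc k)) has_real_derivative 0) (at t)"
    by (rule has_field_derivative_transform_within_open[where S = "{..<0}"]) (use less in auto)
  with less show ?thesis by simp
next
  case greater
  have "((\<lambda>t::real. t ^ Suc (Suc k)) has_real_derivative real (Suc (Suc k)) * t ^ Suc k) (at t)"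
    using DERIV_pow[of "Suc (Suc k)" t] by simp
  then have "((\<lambda>t::real. max 0 t ^ Suc (Suc k)) has_real_derivative real (Suc (Suc k)) * t ^ Suc k) (at t)"
    by (rule has_field_derivative_transform_within_open[where S = "{0<..}"]) (use greater in auto)
  with greater show ?thesis by simp
next
  case equal
  \<comment> \<open>For \<open>h \<noteq> 0\<close> the difference quotient at 0 equals
    \<open>max 0 h ^ Suc k\<close>, which tends to 0.\<close>
  have "((\<lambda>h::real. max 0 h ^ Suc k) \<longlongrightarrow> max 0 0 ^ Suc k) (at 0)"
    by (intro tendsto_intros)
  then have "((\<lambda>h::real. max 0 h ^ Suc k) \<longlongrightarrow> 0) (at 0)"
    by simp
  then have "((\<lambda>h::real. max 0 h ^ Suc (Suc k) / h) \<longlongrightarrow> 0) (at 0)"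
    by (rule Lim_transform_eventually) (auto simp: eventually_at_filter max_def)
  then show ?thesis
    by (simp add: equal DERIV_def)
qed

text \<open>Each differentiation lowers the exponent by one. Starting from \<open>Suc k\<close>,
  exponent 1 remains after \<open>k\<close> steps, and the positive part itself is
  continuous.\<close>

lemma Ck_on_max_0_power:
  assumes "open U" "real_polynomial_function p"
  shows "Ck_on k U (\<lambda>x. max 0 (p x) ^ Suc k)"
proof (induction k)
  case 0
  show ?case
    using Ck_on_real_polynomial_function[OF assms, of 0] by (auto intro: continuous_intros)
next
  case (Suc k)
  note p = Ck_on_SucD[OF Ck_on_real_polynomial_function[OF assms, of "Suc k"]]
  show ?case
  proof (rule Ck_on_SucI[OF assms(1)])
    show "((\<lambda>x. max 0 (p x) ^ Suc (Suc k)) has_derivative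
        (\<lambda>h. frechet_derivative p (at x) h * (real (Suc (Suc k)) * max 0 (p x) ^ Suc k))) (at x)"
      if "x \<in> U" for x
      using has_derivative_compose[OF p(1)[OF that]
          has_real_derivative_max_0_power[unfolded has_field_derivative_def, of k "p x"]]
      by (simp add: mult_ac)
    show "Ck_on k U (\<lambda>x. frechet_derivative p (at x) b * (real (Suc (Suc k)) * max 0 (p x) ^ Suc k))"
      if "b \<in> Basis" for b
      by (intro Ck_on_mult Ck_on_const Suc.IH p(2) that assms(1))
  qed
qed

section \<open>Rational expressions in truncated polynomials\<close>

lemma open_semialgebraic_polynomial_positive:
  assumes "finite I" "\<And>i. i \<in> I \<Longrightarrow> real_polynomial_function (q i)"
  shows "open {x. \<exists>i\<in>I. 0 < q i x}" "semialgebraic {x. \<exists>i\<in>I. 0 < q i x}"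
proof -
  have eq: "{x. \<exists>i\<in>I. 0 < q i x} = (\<Union>i\<in>I. {x. 0 < q i x})"
    by auto
  have "continuous_on UNIV (q i)" if "i \<in> I" for i
    using Ck_on_real_polynomial_function[OF open_UNIV assms(2)[OF that], of 0] by simp
  then show "open {x. \<exists>i\<in>I. 0 < q i x}"
    unfolding eq by (intro open_UN ballI open_Collect_less continuous_on_const)
  show "semialgebraic {x. \<exists>i\<in>I. 0 < q i x}"
    unfolding eq by (intro semialgebraic_UN semialgebraic.positive assms)
qed

lemma sum_max_0_power_pos:
  fixes q :: "'i \<Rightarrow> real"
  assumes "finite I" "\<exists>i\<in>I. 0 < q i"
  shows "0 < (\<Sum>i\<in>I. max 0 (q i) ^ n)"
proof -
  obtain i where "i \<in> I" "0 < q i" using assms(2) by blast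
  then show ?thesis
    using assms(1) by (intro sum_pos2[of I i]) auto
qed

text \<open>This is one coordinate of the approximating map: a weighted mean of the numbers
  \<open>a i\<close>. The domain is exactly the set where the total weight is positive.\<close>

lemma Snu_open_truncated_quotient:
  fixes q :: "'i \<Rightarrow> 'a::euclidean_space \<Rightarrow> real" and a :: "'i \<Rightarrow> real"
  assumes I: "finite I" and q: "\<And>i. i \<in> I \<Longrightarrow> real_polynomial_function (q i)"
  shows "Snu_open \<nu> {x. \<exists>i\<in>I. 0 < q i x}
    (\<lambda>x. (\<Sum>i\<in>I. a i * max 0 (q i x) ^ Suc \<nu>) * inverse (\<Sum>i\<in>I. max 0 (q i x) ^ Suc \<nu>))"
    (is "Snu_open \<nu> ?U ?F")
  unfolding Snu_open_def
proof (intro conjI)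
  show U: "open ?U" and "semialgebraic ?U"
    using open_semialgebraic_polynomial_positive[OF I q] by auto
  have "(\<Sum>i\<in>I. max 0 (q i x) ^ Suc \<nu>) \<noteq> 0" if "x \<in> ?U" for x
    using sum_max_0_power_pos[OF I, of "\<lambda>i. q i x" "Suc \<nu>"] that by simp
  then show "Ck_on \<nu> ?U ?F"
    by (intro Ck_on_mult Ck_on_inverse Ck_on_sum Ck_on_max_0_power Ck_on_const U I q)
  \<comment> \<open>\<open>E J\<close> is the equation of the graph with the denominator cleared and
    truncation dropped. This is legitimate where \<open>J\<close> is precisely the set of indices
    with positive \<open>q i\<close>, a condition expressed by the sets \<open>P i\<close>.\<close>
  define E where "E J = {z :: 'a \<times> real.
    snd z * (\<Sum>i\<in>J. q i (fst z) ^ Suc \<nu>) - (\<Sum>i\<in>J. a i * q i (fst z) ^ Suc \<nu>) = 0}" for J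
  define P where "P i = {z :: 'a \<times> real. 0 < q i (fst z)}" for i
  have qfst: "real_polynomial_function (\<lambda>z :: 'a \<times> real. q i (fst z))" if "i \<in> I" for i
    using real_polynomial_function_compose[OF polynomial_function_bounded_linear[OF bounded_linear_fst] q[OF that]]
    by (simp add: o_def)
  have rsnd: "real_polynomial_function (snd :: 'a \<times> real \<Rightarrow> real)"
    by (intro real_polynomial_function.intros(1) bounded_linear_snd)
  have P: "semialgebraic (P i)" if "i \<in> I" for i
    unfolding P_def by (intro semialgebraic.positive qfst that)
  have E: "semialgebraic (E J)" if "J \<subseteq> I" for J
    unfolding E_def using that I qfst
    by (intro semialgebraic_zero real_polynomial_function_diff real_polynomial_function.intros(4) rsnd
        real_polynomial_function_sum real_polynomial_function_power real_polynomial_function.intros(2))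
      (auto dest: finite_subset)
  text \<open>Once the set \<open>J\<close> of indices with positive \<open>q i\<close> is fixed, the graph is cut out by one
    polynomial equation.\<close>
  have "{(x, ?F x) | x. x \<in> ?U} =
      (\<Union>J\<in>Pow I - {{}}. (\<Inter>i\<in>J. P i) \<inter> (\<Inter>i\<in>I - J. - P i) \<inter> E J)" (is "?L = ?R")
  proof -
    have restrict: "(\<Sum>i\<in>I. c i * max 0 (q i x) ^ Suc \<nu>) = (\<Sum>i\<in>J. c i * q i x ^ Suc \<nu>)"
      if "J \<subseteq> I" "\<And>i. i \<in> J \<Longrightarrow> 0 < q i x" "\<And>i. i \<in> I - J \<Longrightarrow> \<not> 0 < q i x" for J x c
    proof (intro sum.mono_neutral_cong_right I that(1) ballI)
      show "c i * max 0 (q i x) ^ Suc \<nu> = 0" if "i \<in> I - J" for i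
        using \<open>\<And>i. i \<in> I - J \<Longrightarrow> \<not> 0 < q i x\<close>[OF that] by (simp add: max_def)
      show "c i * max 0 (q i x) ^ Suc \<nu> = c i * q i x ^ Suc \<nu>" if "i \<in> J" for i
        using \<open>\<And>i. i \<in> J \<Longrightarrow> 0 < q i x\<close>[OF that] by (simp add: max_def)
    qed
    \<comment> \<open>A nonempty \<open>J\<close> makes the denominator positive, so clearing it is
      reversible. The empty \<open>J\<close>, left out of the union, corresponds to points outside
      the domain.\<close>
    have mem: "z \<in> E J \<longleftrightarrow> snd z = ?F (fst z)"
      if J: "J \<subseteq> I" "\<And>i. i \<in> J \<Longrightarrow> 0 < q i (fst z)" "\<And>i. i \<in> I - J \<Longrightarrow> \<not> 0 < q i (fst z)"
        and "J \<noteq> {}" for J z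
    proof -
      have "0 < (\<Sum>i\<in>I. max 0 (q i (fst z)) ^ Suc \<nu>)"
        using that by (intro sum_max_0_power_pos I) auto
      then show ?thesis
        using restrict[OF J, of a] restrict[OF J, of "\<lambda>_. 1"]
        unfolding E_def by (auto simp: field_simps)
    qed
    show ?thesis
    proof (intro equalityI subsetI)
      fix z assume "z \<in> ?L"
      then obtain x where x: "x \<in> ?U" "z = (x, ?F x)" by blast
      let ?J = "{i \<in> I. 0 < q i x}"
      have "z \<in> E ?J"
        using x by (subst mem) auto
      with x show "z \<in> ?R"
        by (intro UN_I[of ?J]) (auto simp: P_def)
    next
      fix z assume "z \<in> ?R"
      then obtain J where J: "J \<subseteq> I" "J \<noteq> {}" "z \<in> (\<Inter>i\<in>J. P i)" "z \<in> (\<Inter>i\<in>I - J. - P i)"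
        "z \<in> E J" by blast
      have "snd z = ?F (fst z)"
        using J by (subst mem[of J, symmetric]) (auto simp: P_def)
      moreover have "fst z \<in> ?U"
        using J by (auto simp: P_def)
      ultimately show "z \<in> ?L"
        by (cases z) auto
    qed
  qed
  also have "semialgebraic \<dots>"
    using I by (intro semialgebraic_UN semialgebraic_Int semialgebraic_INT semialgebraic.complement P E)
      (auto dest: finite_subset)
  finally show "semialgebraic_on ?U ?F"
    unfolding semialgebraic_on_def .
qed

section \<open>Approximation by maps into the polyhedron\<close>

text \<open>Continuity and semialgebraicity are inherited from the extensions of the coordinates,
  each with its own neighbourhood of \<open>S\<close>.\<close>

lemma Snu_maps_subset_S0_maps:
  fixes S :: "'a::euclidean_space set" and T :: "(real^'n) set"
  assumes "semialgebraic S"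
  shows "Snu_maps \<nu> S T \<subseteq> S0_maps S T"
proof
  fix f :: "'a \<Rightarrow> real^'n" assume f: "f \<in> Snu_maps \<nu> S T"
  then have "\<forall>i. \<exists>U F. S \<subseteq> U \<and> Snu_open \<nu> U F \<and> (\<forall>x\<in>S. F x = f x $ i)"
    by (simp add: Snu_maps_def Snu_function_def)
  then obtain U F where UF: "\<And>i. S \<subseteq> U i" "\<And>i. Snu_open \<nu> (U i) (F i)"
    "\<And>i x. x \<in> S \<Longrightarrow> F i x = f x $ i"
    by metis
  have "continuous_on S (F i)" for i
    using UF(1,2)[of i] continuous_on_subset[OF Ck_on_imp_continuous_on]
    by (auto simp: Snu_open_def)
  then have "continuous_on S (\<lambda>x. f x $ i)" for i
    using UF(3) by (simp cong: continuous_on_cong)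
  then have "continuous_on S f"
    using continuous_on_vec_lambda[of S "\<lambda>i x. f x $ i"] by simp
  moreover have "semialgebraic_on S f"
    using UF by (intro semialgebraic_on_vec[OF assms, of U F]) (auto simp: Snu_open_def)
  ultimately show "f \<in> S0_maps S T"
    using f by (simp add: Snu_maps_def S0_maps_def)
qed

text \<open>The functions \<open>l v\<close> play the role of barycentric coordinates: the points \<open>v\<close> with
  \<open>l v y > 0\<close> lie in every cell containing \<open>y\<close>, and at least one point of the minimal such cell
  occurs among them.\<close>

lemma polyhedron_bump_functions:
  fixes T :: "'a::euclidean_space set"
  assumes T: "compact_polyhedron T" and "e > 0"
  obtains V :: "'a set" and l :: "'a \<Rightarrow> 'a \<Rightarrow> real"
  where "finite V" "\<And>v. continuous_on UNIV (l v)" "\<And>v y. 0 \<le> l v y"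
    "\<And>y. y \<in> T \<Longrightarrow> \<exists>v\<in>V. 0 < l v y"
    "\<And>y. y \<in> T \<Longrightarrow>
      \<exists>\<sigma>. convex \<sigma> \<and> \<sigma> \<subseteq> T \<and> (\<forall>v\<in>V. 0 < l v y \<longrightarrow> v \<in> \<sigma>) \<and> (\<forall>x\<in>\<sigma>. dist y x < e)"
proof -
  obtain K0 where K0: "simplicial_complex K0" "T = \<Union>K0"
    using T by (auto simp: compact_polyhedron_def)
  obtain K where K: "simplicial_complex K" and diam: "\<And>\<sigma>. \<sigma> \<in> K \<Longrightarrow> diameter \<sigma> < e"
    and TK: "T = \<Union>K"
  proof (rule fine_simplicial_subdivision_of_cell_complex[OF \<open>e > 0\<close>, of K0])
    show "finite K0" "\<And>C. C \<in> K0 \<Longrightarrow> polytope C"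
      "\<And>C1 C2. C1 \<in> K0 \<Longrightarrow> C2 \<in> K0 \<Longrightarrow> C1 \<inter> C2 face_of C1"
      using K0 by (auto simp: simplicial_complex_def simplex_imp_polytope)
  qed (use K0 that in auto)
  have fin: "finite K" and poly: "\<And>\<sigma>. \<sigma> \<in> K \<Longrightarrow> polytope \<sigma>"
    and face: "\<And>\<sigma> \<tau>. \<sigma> \<in> K \<Longrightarrow> \<tau> \<in> K \<Longrightarrow> \<sigma> \<inter> \<tau> \<in> K"
    using K unfolding simplicial_complex_def by (blast intro: simplex_imp_polytope)+
  \<comment> \<open>Any point of a nonempty cell serves. The empty face may occur in
    \<open>K\<close>, and its \<open>c\<close> is then arbitrary; this is harmless, because
    \<open>C\<close> below is defined for every point.\<close>
  define c where "c \<sigma> = (SOME x. x \<in> \<sigma>)" for \<sigma> :: "'a set"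
  have c: "c \<sigma> \<in> \<sigma>" if "y \<in> \<sigma>" for \<sigma> y
    unfolding c_def using that by (rule someI)
  \<comment> \<open>A point \<open>y\<close> avoids \<open>C v\<close> iff every cell containing
    \<open>y\<close> also contains \<open>v\<close>. Distance to \<open>C v\<close> therefore
    detects this. Since \<open>infdist\<close> to the empty set is 0, the value 1 is used when no
    cell obstructs.\<close>
  define C where "C v = \<Union>{\<tau>\<in>K. v \<notin> \<tau>}" for v
  define l where "l v y = (if C v = {} then 1 else infdist y (C v))" for v y
  have l_pos: "0 < l v y \<longleftrightarrow> y \<notin> C v" for v y
  proof -
    have "closed (C v)"
      unfolding C_def using fin poly by (intro closed_Union) (auto simp: polytope_imp_closed)
    then show ?thesis
      using infdist_pos_not_in_closed[of "C v" y] by (auto simp: l_def)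
  qed
  show thesis
  proof (rule that[of "c ` K" l])
    show "finite (c ` K)" using fin by simp
    show "continuous_on UNIV (l v)" for v
      unfolding l_def by (cases "C v = {}") (auto intro!: continuous_intros)
    show "0 \<le> l v y" for v y
      by (simp add: l_def infdist_nonneg)
    fix y assume "y \<in> T"
    then obtain \<sigma>0 where "\<sigma>0 \<in> K" "y \<in> \<sigma>0" using TK by blast
    \<comment> \<open>A minimal cell containing \<open>y\<close> is the least one, as its
      intersection with any other cell containing \<open>y\<close> is again a cell. Hence its point
      \<open>c \<sigma>\<close> lies in all cells containing \<open>y\<close>.\<close>
    then obtain \<sigma> where \<sigma>: "\<sigma> \<in> K" "y \<in> \<sigma>"
      and min: "\<And>\<tau>. \<tau> \<in> K \<Longrightarrow> y \<in> \<tau> \<Longrightarrow> \<tau> \<subseteq> \<sigma> \<Longrightarrow> \<sigma> = \<tau>"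
      using finite_has_minimal[of "{\<tau> \<in> K. y \<in> \<tau>}"] fin by auto
    have "\<sigma> \<subseteq> \<tau>" if "\<tau> \<in> K" "y \<in> \<tau>" for \<tau>
      using min[OF face[OF \<sigma>(1) that(1)]] \<sigma>(2) that(2) by blast
    then have "y \<notin> C (c \<sigma>)"
      using c[OF \<sigma>(2)] by (auto simp: C_def)
    then show "\<exists>v\<in>c ` K. 0 < l v y"
      using \<sigma>(1) by (auto simp: l_pos)
    have "dist y x < e" if "x \<in> \<sigma>" for x
      using diameter_bounded_bound[OF polytope_imp_bounded[OF poly[OF \<sigma>(1)]] \<sigma>(2) that]
        diam[OF \<sigma>(1)] by simp
    then show "\<exists>\<sigma>. convex \<sigma> \<and> \<sigma> \<subseteq> T \<and> (\<forall>v\<in>c ` K. 0 < l v y \<longrightarrow> v \<in> \<sigma>) \<and> (\<forall>x\<in>\<sigma>. dist y x < e)"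
      using \<sigma> TK poly polytope_imp_convex by (intro exI[of _ \<sigma>]) (auto simp: l_pos C_def)
  qed
qed

text \<open>The sum of the \<open>h i\<close> attains a positive minimum \<open>M\<close> on a
  nonempty compact set, so the summands cannot all be small at one point. The extra 1 in the divisor
  keeps the sum of the bounds strictly below \<open>M\<close> and the divisor nonzero.\<close>

lemma uniform_positive_lower_bound:
  fixes h :: "'i \<Rightarrow> 'a::topological_space \<Rightarrow> real"
  assumes S: "compact S" and I: "finite I" and h: "\<And>i. i \<in> I \<Longrightarrow> continuous_on S (h i)"
    and nonneg: "\<And>i x. i \<in> I \<Longrightarrow> 0 \<le> h i x"
    and pos: "\<And>x. x \<in> S \<Longrightarrow> \<exists>i\<in>I. 0 < h i x"
  obtains m where "0 < m" "\<And>x. x \<in> S \<Longrightarrow> \<exists>i\<in>I. m \<le> h i x"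
proof (cases "S = {}")
  case True
  then show ?thesis using that[of 1] by simp
next
  case False
  have "continuous_on S (\<lambda>x. \<Sum>i\<in>I. h i x)"
    by (intro continuous_intros h)
  then obtain x0 where x0: "x0 \<in> S" and le: "\<And>x. x \<in> S \<Longrightarrow> (\<Sum>i\<in>I. h i x0) \<le> (\<Sum>i\<in>I. h i x)"
    using continuous_attains_inf[OF S False] by blast
  define M where "M = (\<Sum>i\<in>I. h i x0)"
  have "0 < M"
    using pos[OF x0] I nonneg unfolding M_def by (auto intro: sum_pos2)
  show ?thesis
  proof (rule that[of "M / (real (card I) + 1)"])
    show "0 < M / (real (card I) + 1)" using \<open>0 < M\<close> by simp
    show "\<exists>i\<in>I. M / (real (card I) + 1) \<le> h i x" if "x \<in> S" for x
    proof (rule ccontr)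
      assume "\<not> ?thesis"
      then have "(\<Sum>i\<in>I. h i x) \<le> (\<Sum>i\<in>I. M / (real (card I) + 1))"
        by (intro sum_mono) (auto simp: not_le less_imp_le)
      also have "\<dots> < M"
        using \<open>0 < M\<close> by (simp add: field_simps)
      finally show False
        using le[OF that] by (simp add: M_def)
    qed
  qed
qed

lemma Snu_maps_approximate:
  fixes S :: "'a::euclidean_space set" and T :: "(real^'n) set"
  assumes S: "compact S" and T: "compact_polyhedron T"
    and f: "continuous_on S f" "f \<in> S \<rightarrow> T" and "e > 0"
  obtains g where "g \<in> Snu_maps \<nu> S T" "\<And>x. x \<in> S \<Longrightarrow> dist (f x) (g x) < e"
proof -
  obtain V :: "(real^'n) set" and l :: "real^'n \<Rightarrow> real^'n \<Rightarrow> real"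
    where V: "finite V" and l: "\<And>v. continuous_on UNIV (l v)"
    "\<And>v y. 0 \<le> l v y" "\<And>y. y \<in> T \<Longrightarrow> \<exists>v\<in>V. 0 < l v y"
    and cell: "\<And>y. y \<in> T \<Longrightarrow>
      \<exists>\<sigma>. convex \<sigma> \<and> \<sigma> \<subseteq> T \<and> (\<forall>v\<in>V. 0 < l v y \<longrightarrow> v \<in> \<sigma>) \<and> (\<forall>x\<in>\<sigma>. dist y x < e)"
    using polyhedron_bump_functions[OF T \<open>e > 0\<close>] by blast
  have cont: "continuous_on S (\<lambda>x. l v (f x))" for v
    using continuous_on_compose2[OF l(1) f(1)] by simp
  obtain m where "0 < m" and m: "\<And>x. x \<in> S \<Longrightarrow> \<exists>v\<in>V. m \<le> l v (f x)"
    using uniform_positive_lower_bound[OF S V, of "\<lambda>v x. l v (f x)"] cont l f(2) by (metis Pi_mem)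
  have "\<exists>p. real_polynomial_function p \<and> (\<forall>x\<in>S. \<bar>l v (f x) - p x\<bar> < m / 3)" for v
    using Stone_Weierstrass_real_polynomial_function[OF S cont, of "m / 3" v] \<open>0 < m\<close>
    by (metis zero_less_divide_iff zero_less_numeral)
  then obtain p where p: "\<And>v. real_polynomial_function (p v)"
    "\<And>v x. x \<in> S \<Longrightarrow> \<bar>l v (f x) - p v x\<bar> < m / 3"
    by metis
  \<comment> \<open>With error below \<open>m / 3\<close>, the shift by \<open>m / 3\<close> ensures
    that \<open>q v x > 0\<close> forces \<open>l v (f x) > 0\<close>. Conversely
    \<open>l v (f x) \<ge> m\<close> gives \<open>p v x > 2 * m / 3\<close>, hence
    \<open>q v x > 0\<close>.\<close>
  define q where "q v x = p v x - m / 3" for v x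
  have q: "real_polynomial_function (q v)" for v
    unfolding q_def by (intro real_polynomial_function_diff p real_polynomial_function.intros(2))
  have q_pos: "0 < l v (f x)" if "x \<in> S" "0 < q v x" for v x
    using p(2)[OF that(1), of v] that(2) unfolding q_def by linarith
  have ex_q: "\<exists>v\<in>V. 0 < q v x" if x: "x \<in> S" for x
  proof -
    obtain v where "v \<in> V" "m \<le> l v (f x)" using m[OF x] by blast
    then show ?thesis
      using p(2)[OF x, of v] \<open>0 < m\<close> unfolding q_def by (intro bexI[of _ v]) linarith+
  qed
  define s where "s x = (\<Sum>v\<in>V. max 0 (q v x) ^ Suc \<nu>)" for x
  define g where "g x = (\<Sum>v\<in>V. (max 0 (q v x) ^ Suc \<nu> / s x) *\<^sub>R v)" for x
  have g_cell: "g x \<in> \<sigma>" if "x \<in> S" "convex \<sigma>" "\<forall>v\<in>V. 0 < l v (f x) \<longrightarrow> v \<in> \<sigma>" for x \<sigma>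
  proof -
    let ?w = "\<lambda>v. max 0 (q v x) ^ Suc \<nu> / s x"
    let ?J = "{v \<in> V. 0 < q v x}"
    have s: "0 < s x"
      unfolding s_def by (intro sum_max_0_power_pos V ex_q that)
    have "sum ?w V = 1"
      using s by (simp add: s_def flip: sum_divide_distrib)
    \<comment> \<open>Points with weight zero need not lie in \<open>\<sigma>\<close>, so they are
      discarded before convexity is applied.\<close>
    moreover have "sum ?w V = sum ?w ?J"
      using V by (intro sum.mono_neutral_right) auto
    ultimately have "(\<Sum>v\<in>?J. ?w v *\<^sub>R v) \<in> \<sigma>"
      using V that q_pos[OF that(1)] s by (intro convex_sum) (auto intro!: divide_nonneg_pos)
    also have "(\<Sum>v\<in>?J. ?w v *\<^sub>R v) = g x"
      unfolding g_def using V by (intro sum.mono_neutral_left) auto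
    finally show ?thesis .
  qed
  \<comment> \<open>A single cell gives both claims: it lies in \<open>T\<close>, contains
    \<open>g x\<close>, and all its points are within \<open>e\<close> of
    \<open>f x\<close>.\<close>
  have g: "g x \<in> T \<and> dist (f x) (g x) < e" if x: "x \<in> S" for x
    using cell[of "f x"] g_cell[OF x] f(2) x by blast
  \<comment> \<open>On \<open>S\<close> the coordinate \<open>i\<close> of \<open>g\<close> is the
    quotient with coefficients \<open>v $ i\<close>. Restricting \<open>g\<close> makes it
    extensional, as \<open>Snu_maps\<close> requires.\<close>
  have "Snu_function \<nu> S (\<lambda>x. restrict g S x $ i)" for i
    unfolding Snu_function_def
  proof (intro exI conjI)
    show "Snu_open \<nu> {x. \<exists>v\<in>V. 0 < q v x}
      (\<lambda>x. (\<Sum>v\<in>V. v $ i * max 0 (q v x) ^ Suc \<nu>) * inverse (\<Sum>v\<in>V. max 0 (q v x) ^ Suc \<nu>))"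
      by (rule Snu_open_truncated_quotient[OF V q])
    show "S \<subseteq> {x. \<exists>v\<in>V. 0 < q v x}" using ex_q by blast
    show "\<forall>x\<in>S. (\<Sum>v\<in>V. v $ i * max 0 (q v x) ^ Suc \<nu>) *
        inverse (\<Sum>v\<in>V. max 0 (q v x) ^ Suc \<nu>) = restrict g S x $ i"
      by (auto simp: g_def s_def sum_distrib_right divide_inverse simp del: power_Suc intro!: sum.cong)
  qed
  with g show thesis
    by (intro that[of "restrict g S"]) (auto simp: Snu_maps_def)
qed

theorem corollary8:
  fixes S :: "(real^'m) set" and T :: "(real^'n) set" and \<nu> :: nat
  assumes "compact S" and "semialgebraic S"
    and "compact_polyhedron T"
    and "\<nu> \<ge> 1"
  shows "dense_in (uniform_topology S (S0_maps S T)) (Snu_maps \<nu> S T)"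
  unfolding dense_in_def topspace_uniform_topology
proof (intro conjI equalityI subsetI)
  show sub: "f \<in> S0_maps S T" if "f \<in> Snu_maps \<nu> S T" for f
    using Snu_maps_subset_S0_maps[OF assms(2)] that by blast
  let ?X = "uniform_topology S (S0_maps S T)"
  show "f \<in> S0_maps S T" if "f \<in> ?X closure_of Snu_maps \<nu> S T" for f
    using that closure_of_subset_topspace[of ?X] by auto
  fix f assume f: "f \<in> S0_maps S T"
  show "f \<in> ?X closure_of Snu_maps \<nu> S T"
    unfolding in_closure_of topspace_uniform_topology
  proof (intro conjI allI impI f)
    fix W assume W: "f \<in> W \<and> openin ?X W"
    then obtain e where "e > 0"
      and e: "\<And>g. g \<in> S0_maps S T \<Longrightarrow> (\<forall>x\<in>S. dist (f x) (g x) < e) \<Longrightarrow> g \<in> W"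
      unfolding openin_uniform_topology by blast
    have "continuous_on S f" "f \<in> S \<rightarrow> T"
      using f by (auto simp: S0_maps_def)
    from Snu_maps_approximate[OF assms(1,3) this \<open>e > 0\<close>]
    obtain g where "g \<in> Snu_maps \<nu> S T" "\<And>x. x \<in> S \<Longrightarrow> dist (f x) (g x) < e" by blast
    \<comment> \<open>The uniform ball around \<open>f\<close> only captures maps in
      \<open>S0_maps S T\<close>, hence the appeal to \<open>sub\<close>.\<close>
    then show "\<exists>g. g \<in> Snu_maps \<nu> S T \<and> g \<in> W"
      using e sub by blast
  qed
qed

end
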